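(* If $L$ is a cyclically transitive linear order, then the reversed linear order $L^*$ is cyclically transitive.
   Context: Linear orders may be empty. $L^*$ is the same underlying set as $L$ with the reverse order. $L_1+L_2$ denotes the ordered sum (every element of $L_1$ strictly below every element of $L_2$); a partition $L=L_1+L_2$ means that $L_1$ is an initial segment of $L$ and $L_2$ is its complement (either may be empty). $L$ is cyclically transitive if for any $a\le b$ in $L$ there exist partitions $L=L_1+L_2=L_2'+L_1'$ with $a\in L_1$, $b\in L_1'$, and order isomorphisms $F_1:L_1\to L_1'$, $F_2:L_2\to L_2'$ satisfying $F_1(a)=b$. *)

theory Defs
  imports Main
begin

text \<open>
  A linear order is a reflexive relation \<open>r\<close> with \<open>Linear_order r\<close>; its underlying set is
  \<open>Field r\<close>, which may be empty, and the reversed order is \<open>r\<inverse>\<close>.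
\<close>

definition order_partition :: "'a rel \<Rightarrow> 'a set \<Rightarrow> 'a set \<Rightarrow> bool" where
  "order_partition r L1 L2 \<longleftrightarrow> ofilter r L1 \<and> L2 = Field r - L1"

text \<open>
  A subset \<open>S\<close> of \<open>Field r\<close> carries the induced order \<open>Restr r S\<close>, whose field is \<open>S\<close>.
  The library constant \<^const>\<open>iso\<close> is defined through \<^const>\<open>embed\<close>, but on arbitrary relations it
  means a bijection of the fields that preserves and reflects the relation, see \<open>iso_iff2\<close>.
\<close>

definition cyclically_transitive :: "'a rel \<Rightarrow> bool" where
  "cyclically_transitive r \<longleftrightarrow>
    (\<forall>a b. (a, b) \<in> r \<longrightarrow>
      (\<exists>L1 L2 L1' L2' F1 F2.
        order_partition r L1 L2 \<and> order_partition r L2' L1' \<and>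
        a \<in> L1 \<and> b \<in> L1' \<and>
        iso (Restr r L1) (Restr r L1') F1 \<and>
        iso (Restr r L2) (Restr r L2') F2 \<and>
        F1 a = b))"

end

(* The decompositions that move b to a in L are, read backwards, decompositions that
   move a to b in the reversed order: swap the roles of the two partitions and invert
   the isomorphisms. *)

theory Submission
  imports Defs
begin

text \<open>Reversal swaps the summands of an ordered sum (\<open>order_partition_converse\<close>).
  So if L = L1 + L2 = L2' + L1' moves b to a, the reversed order is L1' + L2' = L2 + L1, with a in
  its first initial segment L1' and b in the final segment L1. The inverses of F1 and F2 go in the
  required directions, remain isomorphisms for the reversed orders
  (\<open>iso_Restr_converse_inv_into\<close>), and send a to b.\<close>

text \<open>The complement of a downward closed set is upward closed, that is, downward closed for
  the converse.\<close>

lemma order_partition_converse: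
  assumes "order_partition r A B"
  shows "order_partition (r\<inverse>) B A"
  using assms unfolding order_partition_def ofilter_def under_def
  by (auto dest: FieldI2)

lemma iso_inv_into:
  assumes "iso r s f"
  shows "iso s r (inv_into (Field r) f)"
proof -
  have bij: "bij_betw f (Field r) (Field s)"
    and rel: "\<And>x y. x \<in> Field r \<Longrightarrow> y \<in> Field r \<Longrightarrow> (x, y) \<in> r \<longleftrightarrow> (f x, f y) \<in> s"
    using assms unfolding iso_iff2 by auto
  have "(x, y) \<in> s \<longleftrightarrow> (inv_into (Field r) f x, inv_into (Field r) f y) \<in> r"
    if "x \<in> Field s" "y \<in> Field s" for x y
    using that rel[of "inv_into (Field r) f x" "inv_into (Field r) f y"]
    by (simp add: bij_betw_inv_into_right[OF bij]
        bij_betw_apply[OF bij_betw_inv_into[OF bij]])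
  then show ?thesis
    unfolding iso_iff2 using bij_betw_inv_into[OF bij] by blast
qed

lemma iso_converse: "iso r s f \<Longrightarrow> iso (r\<inverse>) (s\<inverse>) f"
  unfolding iso_iff2 by auto

lemma Restr_converse: "Restr (r\<inverse>) A = (Restr r A)\<inverse>"
  by auto

lemma iso_Restr_converse_inv_into:
  assumes "iso (Restr r A) (Restr r B) f"
  shows "iso (Restr (r\<inverse>) B) (Restr (r\<inverse>) A) (inv_into (Field (Restr r A)) f)"
  unfolding Restr_converse by (intro iso_converse iso_inv_into assms)

theorem corollary4p7:
  fixes r :: "'a rel"
  assumes "Linear_order r"
    and "cyclically_transitive r"
  shows "cyclically_transitive (r\<inverse>)"
  unfolding cyclically_transitive_def
proof (intro allI impI)
  fix a b
  assume "(a, b) \<in> r\<inverse>"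
  then have "(b, a) \<in> r" by simp
  then obtain L1 L2 L1' L2' F1 F2 where
    part: "order_partition r L1 L2" "order_partition r L2' L1'"
    and mem: "b \<in> L1" "a \<in> L1'"
    and iso1: "iso (Restr r L1) (Restr r L1') F1"
    and iso2: "iso (Restr r L2) (Restr r L2') F2"
    and F1: "F1 b = a"
    using assms(2) unfolding cyclically_transitive_def by blast
  let ?G1 = "inv_into (Field (Restr r L1)) F1"
  let ?G2 = "inv_into (Field (Restr r L2)) F2"
  \<comment> \<open>\<open>inv_into\<close> undoes \<open>F1\<close> only on the field of the
    restriction; the reflexive pair at b puts b there.\<close>
  have "(b, b) \<in> r"
    using \<open>(b, a) \<in> r\<close> assms(1)
    by (auto simp: order_on_defs intro: refl_onD FieldI1)
  then have "b \<in> Field (Restr r L1)"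
    using mem(1) by (auto intro: FieldI1)
  moreover have "inj_on F1 (Field (Restr r L1))"
    using iso1 unfolding iso_iff2 bij_betw_def by blast
  ultimately have "?G1 a = b"
    unfolding F1[symmetric] by (rule inv_into_f_f[rotated])
  with part[THEN order_partition_converse] mem
    iso_Restr_converse_inv_into[OF iso1] iso_Restr_converse_inv_into[OF iso2]
  show "\<exists>L1 L2 L1' L2' F1 F2.
      order_partition (r\<inverse>) L1 L2 \<and> order_partition (r\<inverse>) L2' L1' \<and>
      a \<in> L1 \<and> b \<in> L1' \<and>
      iso (Restr (r\<inverse>) L1) (Restr (r\<inverse>) L1') F1 \<and>
      iso (Restr (r\<inverse>) L2) (Restr (r\<inverse>) L2') F2 \<and>
      F1 a = b"
    \<comment> \<open>Primed and unprimed pieces trade places, since both the order and the maps are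
      inverted.\<close>
    by (intro exI[of _ L1'] exI[of _ L2'] exI[of _ L1] exI[of _ L2]
        exI[of _ ?G1] exI[of _ ?G2] conjI)
qed

end
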